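(* Suppose that $\Psi$ is countable with $\nu_\Psi$ equal to counting measure, that $\pi_\Psi(\psi)>0$ for every $\psi\in\Psi$, and that $\psi_{\mathrm{LRSE}}(x)$ is the unique maximizer of $\psi\mapsto\pi_\Psi(\psi\,|\,x)/\pi_\Psi(\psi)$ for all $x$. For $\eta>0$ let $\delta_\eta$ be a Bayes rule for the loss function $$L_\eta(\theta,\psi)=\frac{I(\Psi(\theta)\neq\psi)}{\max(\eta,\pi_\Psi(\Psi(\theta)))}.$$ Then $\delta_\eta(x)\to\psi_{\mathrm{LRSE}}(x)$ as $\eta\to0$, for every $x\in\mathcal X$.
   Context: Setting: $\{f_\theta:\theta\in\Theta\}$ is a family of probability densities with respect to a support measure $\mu$ on a sample space $\mathcal X$. $\Pi$ is a proper prior (probability measure) on $\Theta$ with density $\pi$ with respect to a support measure $\nu$. Put $m(x)=\int_\Theta \pi(\theta)f_\theta(x)\,\nu(d\theta)$. The posterior $\Pi(\cdot\,|\,x)$ has density $\pi(\theta\,|\,x)=\pi(\theta)f_\theta(x)/m(x)$ with respect to $\nu$ (points $x$ are those at which this is defined, i.e. $0<m(x)<\infty$). A (measurable) map $\Psi:\Theta\to\Psi$ is given; the same symbol $\Psi$ denotes the map and its target space. $\Pi_\Psi$ and $\Pi_\Psi(\cdot\,|\,x)$ are the marginal prior and marginal posterior of $\psi=\Psi(\theta)$, with densities $\pi_\Psi$ and $\pi_\Psi(\cdot\,|\,x)$ with respect to a support measure $\nu_\Psi$ on $\Psi$. $I(\cdot)$ is the indicator. The least relative surprise estimator $\psi_{\mathrm{LRSE}}(x)$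 is the maximizer of the relative belief ratio $\pi_\Psi(\psi\,|\,x)/\pi_\Psi(\psi)$ over $\psi\in\Psi$. For a loss function $L:\Theta\times\Psi\to[0,\infty)$ and a decision function $\delta:\mathcal X\to\Psi$, the posterior risk is $r(\delta\,|\,x)=\int_\Theta L(\theta,\delta(x))\pi(\theta\,|\,x)\,\nu(d\theta)$. A Bayes rule is here understood pointwise: for each $x$ its value $\delta(x)$ minimizes the posterior risk at $x$ over all possible values in $\Psi$ (such a rule also minimizes the prior risk $\int_{\mathcal X}r(\delta\,|\,x)m(x)\,\mu(dx)$). Convergence in the countable space $\Psi$ is with respect to the discrete topology. *)

theory Defs
  imports "HOL-Probability.Probability"
begin

(* The evidence m is ennreal-valued, so that the finiteness of m(x) is a genuine condition
   and not an artefact of the Bochner integral being 0 for non-integrable functions. *)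
definition evidence :: "'t measure \<Rightarrow> ('t \<Rightarrow> real) \<Rightarrow> ('t \<Rightarrow> 'x \<Rightarrow> real) \<Rightarrow> 'x \<Rightarrow> ennreal" where
  "evidence \<nu> p f x = (\<integral>\<^sup>+ \<theta>. ennreal (p \<theta> * f \<theta> x) \<partial>\<nu>)"

definition sample_points ::
  "'x measure \<Rightarrow> 't measure \<Rightarrow> ('t \<Rightarrow> real) \<Rightarrow> ('t \<Rightarrow> 'x \<Rightarrow> real) \<Rightarrow> 'x set" where
  "sample_points \<mu> \<nu> p f = {x \<in> space \<mu>. 0 < evidence \<nu> p f x \<and> evidence \<nu> p f x < \<infinity>}"

definition posterior_density ::
  "'t measure \<Rightarrow> ('t \<Rightarrow> real) \<Rightarrow> ('t \<Rightarrow> 'x \<Rightarrow> real) \<Rightarrow> 'x \<Rightarrow> 't \<Rightarrow> real" where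
  "posterior_density \<nu> p f x \<theta> = p \<theta> * f \<theta> x / enn2real (evidence \<nu> p f x)"

definition prior_measure :: "'t measure \<Rightarrow> ('t \<Rightarrow> real) \<Rightarrow> 't measure" where
  "prior_measure \<nu> p = density \<nu> (\<lambda>\<theta>. ennreal (p \<theta>))"

definition posterior_measure ::
  "'t measure \<Rightarrow> ('t \<Rightarrow> real) \<Rightarrow> ('t \<Rightarrow> 'x \<Rightarrow> real) \<Rightarrow> 'x \<Rightarrow> 't measure" where
  "posterior_measure \<nu> p f x = density \<nu> (\<lambda>\<theta>. ennreal (posterior_density \<nu> p f x \<theta>))"

(* g is a nonnegative real-valued density, with respect to N, of the image of M under X. *)
definition has_marginal_density ::
  "'t measure \<Rightarrow> 'p measure \<Rightarrow> ('t \<Rightarrow> 'p) \<Rightarrow> ('p \<Rightarrow> real) \<Rightarrow> bool" where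
  "has_marginal_density M N X g \<longleftrightarrow>
     distributed M N X (\<lambda>y. ennreal (g y)) \<and> (\<forall>y\<in>space N. 0 \<le> g y)"

(* The parameter space is the space of \<nu>, the sample space that of \<mu>, and the target
   space of the map \<Psi> that of \<nu>\<Psi>.  The functions p\<Psi> and q\<Psi> x are the marginal prior density
   and the marginal posterior density given x.  No joint measurability of f and no
   sigma-finiteness is required. *)
locale bayes_model =
  fixes \<mu> :: "'x measure" and \<nu> :: "'t measure" and \<nu>\<Psi> :: "'p measure"
    and f :: "'t \<Rightarrow> 'x \<Rightarrow> real" and p :: "'t \<Rightarrow> real" and \<Psi> :: "'t \<Rightarrow> 'p"
    and p\<Psi> :: "'p \<Rightarrow> real" and q\<Psi> :: "'x \<Rightarrow> 'p \<Rightarrow> real"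
  assumes f_nonneg: "\<And>\<theta> x. \<theta> \<in> space \<nu> \<Longrightarrow> x \<in> space \<mu> \<Longrightarrow> 0 \<le> f \<theta> x"
    and f_measurable: "\<And>\<theta>. \<theta> \<in> space \<nu> \<Longrightarrow> f \<theta> \<in> borel_measurable \<mu>"
    and f_prob: "\<And>\<theta>. \<theta> \<in> space \<nu> \<Longrightarrow> prob_space (density \<mu> (\<lambda>x. ennreal (f \<theta> x)))"
    and f_measurable_param: "\<And>x. x \<in> space \<mu> \<Longrightarrow> (\<lambda>\<theta>. f \<theta> x) \<in> borel_measurable \<nu>"
    and p_nonneg: "\<And>\<theta>. \<theta> \<in> space \<nu> \<Longrightarrow> 0 \<le> p \<theta>"
    and p_measurable: "p \<in> borel_measurable \<nu>"
    and prior_prob: "prob_space (prior_measure \<nu> p)"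
    and \<Psi>_measurable: "\<Psi> \<in> measurable \<nu> \<nu>\<Psi>"
    and marginal_prior: "has_marginal_density (prior_measure \<nu> p) \<nu>\<Psi> \<Psi> p\<Psi>"
    and marginal_posterior: "\<And>x. x \<in> sample_points \<mu> \<nu> p f \<Longrightarrow>
          has_marginal_density (posterior_measure \<nu> p f x) \<nu>\<Psi> \<Psi> (q\<Psi> x)"

definition relative_belief :: "('p \<Rightarrow> real) \<Rightarrow> ('x \<Rightarrow> 'p \<Rightarrow> real) \<Rightarrow> 'x \<Rightarrow> 'p \<Rightarrow> real" where
  "relative_belief p\<Psi> q\<Psi> x \<psi> = q\<Psi> x \<psi> / p\<Psi> \<psi>"

definition is_LRSE ::
  "'p measure \<Rightarrow> ('p \<Rightarrow> real) \<Rightarrow> ('x \<Rightarrow> 'p \<Rightarrow> real) \<Rightarrow> 'x \<Rightarrow> 'p \<Rightarrow> bool" where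
  "is_LRSE \<nu>\<Psi> p\<Psi> q\<Psi> x \<psi> \<longleftrightarrow> is_arg_max (relative_belief p\<Psi> q\<Psi> x) (\<lambda>\<psi>. \<psi> \<in> space \<nu>\<Psi>) \<psi>"

(* Posterior risk at x of the action a = \<delta>(x); the loss is nonnegative, and an infinite risk
   is represented as such. *)
definition posterior_risk ::
  "'t measure \<Rightarrow> ('t \<Rightarrow> real) \<Rightarrow> ('t \<Rightarrow> 'x \<Rightarrow> real) \<Rightarrow> ('t \<Rightarrow> 'p \<Rightarrow> real) \<Rightarrow> 'x \<Rightarrow> 'p \<Rightarrow> ennreal" where
  "posterior_risk \<nu> p f L x a = (\<integral>\<^sup>+ \<theta>. ennreal (L \<theta> a * posterior_density \<nu> p f x \<theta>) \<partial>\<nu>)"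

definition is_Bayes_rule ::
  "'x measure \<Rightarrow> 't measure \<Rightarrow> 'p measure \<Rightarrow> ('t \<Rightarrow> real) \<Rightarrow> ('t \<Rightarrow> 'x \<Rightarrow> real) \<Rightarrow>
   ('t \<Rightarrow> 'p \<Rightarrow> real) \<Rightarrow> ('x \<Rightarrow> 'p) \<Rightarrow> bool" where
  "is_Bayes_rule \<mu> \<nu> \<nu>\<Psi> p f L \<delta> \<longleftrightarrow>
     (\<forall>x\<in>sample_points \<mu> \<nu> p f.
        is_arg_min (posterior_risk \<nu> p f L x) (\<lambda>\<psi>. \<psi> \<in> space \<nu>\<Psi>) (\<delta> x))"

definition LRSE_loss :: "('t \<Rightarrow> 'p) \<Rightarrow> ('p \<Rightarrow> real) \<Rightarrow> real \<Rightarrow> 't \<Rightarrow> 'p \<Rightarrow> real" where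
  "LRSE_loss \<Psi> p\<Psi> \<eta> \<theta> \<psi> = of_bool (\<Psi> \<theta> \<noteq> \<psi>) / max \<eta> (p\<Psi> (\<Psi> \<theta>))"

end

theory Submission
  imports Defs
begin

text \<open>
  Fix a sample point. Since the loss of the action \<open>a\<close> is the weight
  \<open>w \<psi> = 1 / max \<eta> (p\<Psi> \<psi>)\<close> of the true value \<open>\<psi>\<close> whenever \<open>\<psi> \<noteq> a\<close>, the posterior risk of \<open>a\<close> is
  the total posterior expected weight minus the single term
  \<open>q\<Psi> a / max \<eta> (p\<Psi> a)\<close>. The total is at most \<open>1 / \<eta>\<close>, hence finite, and so the Bayes actions are
  the maximizers of the truncated ratio \<open>a \<mapsto> q\<Psi> a / max \<eta> (p\<Psi> a)\<close>.

  Truncation can only lower the relative belief ratio, and it leaves the ratio at the LRSE unchanged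
  as soon as \<open>\<eta> \<le> p\<Psi> (\<psi>LRSE)\<close>. For such \<open>\<eta>\<close> the unique maximizer of the relative belief ratio is
  thus also the unique maximizer of the truncated ratio. The Bayes rule therefore equals the LRSE
  for all \<open>\<eta> \<in> (0, p\<Psi> (\<psi>LRSE)]\<close>; being eventually constant, it converges in the discrete topology.
\<close>

lemma (in bayes_model) posterior_density_measurable:
  assumes "x \<in> sample_points \<mu> \<nu> p f"
  shows "posterior_density \<nu> p f x \<in> borel_measurable \<nu>"
proof -
  have [measurable]: "p \<in> borel_measurable \<nu>" "(\<lambda>\<theta>. f \<theta> x) \<in> borel_measurable \<nu>"
    using assms p_measurable f_measurable_param by (auto simp: sample_points_def)
  have "(\<lambda>\<theta>. p \<theta> * f \<theta> x / enn2real (evidence \<nu> p f x)) \<in> borel_measurable \<nu>"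
    by measurable
  then show ?thesis
    by (simp add: posterior_density_def[abs_def])
qed

lemma (in bayes_model) posterior_density_nonneg:
  assumes "x \<in> sample_points \<mu> \<nu> p f" "\<theta> \<in> space \<nu>"
  shows "0 \<le> posterior_density \<nu> p f x \<theta>"
  using assms f_nonneg p_nonneg by (auto simp: posterior_density_def sample_points_def)

lemma (in bayes_model) prob_space_posterior:
  assumes x: "x \<in> sample_points \<mu> \<nu> p f"
  shows "prob_space (posterior_measure \<nu> p f x)"
proof
  define c where "c = enn2real (evidence \<nu> p f x)"
  have ev: "evidence \<nu> p f x = ennreal c" and c: "0 < c"
    using x by (auto simp: c_def sample_points_def enn2real_positive_iff)
  have [measurable]: "p \<in> borel_measurable \<nu>" "(\<lambda>\<theta>. f \<theta> x) \<in> borel_measurable \<nu>"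
    using x p_measurable f_measurable_param by (auto simp: sample_points_def)
  have "emeasure (posterior_measure \<nu> p f x) (space (posterior_measure \<nu> p f x))
      = (\<integral>\<^sup>+ \<theta>. ennreal (posterior_density \<nu> p f x \<theta>) \<partial>\<nu>)"
    using posterior_density_measurable[OF x]
    by (simp add: posterior_measure_def emeasure_density cong: nn_integral_cong)
  also have "\<dots> = (\<integral>\<^sup>+ \<theta>. ennreal (p \<theta> * f \<theta> x) * ennreal (1 / c) \<partial>\<nu>)"
    using c x f_nonneg p_nonneg
    by (intro nn_integral_cong)
       (auto simp: posterior_density_def c_def[symmetric] sample_points_def
          ennreal_mult[symmetric])
  also have "\<dots> = evidence \<nu> p f x * ennreal (1 / c)"
    by (simp add: nn_integral_multc evidence_def)
  also have "\<dots> = 1"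
    using c by (simp add: ev ennreal_mult[symmetric])
  finally show "emeasure (posterior_measure \<nu> p f x) (space (posterior_measure \<nu> p f x)) = 1" .
qed

lemma (in bayes_model) posterior_risk_eq_nn_integral:
  assumes x: "x \<in> sample_points \<mu> \<nu> p f"
    and g: "g \<in> borel_measurable \<nu>\<Psi>"
    and L: "\<And>\<theta>. \<theta> \<in> space \<nu> \<Longrightarrow> L \<theta> a = g (\<Psi> \<theta>)"
  shows "posterior_risk \<nu> p f L x a = (\<integral>\<^sup>+ \<theta>. ennreal (g (\<Psi> \<theta>)) \<partial>posterior_measure \<nu> p f x)"
proof -
  have [measurable]: "posterior_density \<nu> p f x \<in> borel_measurable \<nu>"
    using x by (rule posterior_density_measurable)
  have [measurable]: "(\<lambda>\<theta>. g (\<Psi> \<theta>)) \<in> borel_measurable \<nu>"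
    using \<Psi>_measurable g by (rule measurable_compose)
  show ?thesis
    unfolding posterior_risk_def posterior_measure_def
    by (subst nn_integral_density)
       (auto intro!: nn_integral_cong simp: L posterior_density_nonneg[OF x] ennreal_mult'' mult.commute)
qed

text \<open>
  The posterior expected weight of the true value splits into the risk of \<open>a\<close>, which collects the
  values other than \<open>a\<close>, and the contribution of the point \<open>a\<close>. It is stated as a sum because
  subtraction of extended nonnegative reals is truncated.
\<close>
lemma (in bayes_model) LRSE_loss_posterior_risk:
  assumes x: "x \<in> sample_points \<mu> \<nu> p f"
    and N: "\<nu>\<Psi> = count_space S" and a: "a \<in> S" and \<eta>: "0 < \<eta>"
  shows "posterior_risk \<nu> p f (LRSE_loss \<Psi> p\<Psi> \<eta>) x a + ennreal (q\<Psi> x a / max \<eta> (p\<Psi> a))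
       = (\<integral>\<^sup>+ \<theta>. ennreal (1 / max \<eta> (p\<Psi> (\<Psi> \<theta>))) \<partial>posterior_measure \<nu> p f x)"
proof -
  let ?w = "\<lambda>\<psi>. 1 / max \<eta> (p\<Psi> \<psi>)"
  let ?M = "posterior_measure \<nu> p f x"
  have dist: "distributed ?M (count_space S) \<Psi> (\<lambda>\<psi>. ennreal (q\<Psi> x \<psi>))"
    and q: "\<And>\<psi>. \<psi> \<in> S \<Longrightarrow> 0 \<le> q\<Psi> x \<psi>"
    using marginal_posterior[OF x] by (auto simp: has_marginal_density_def N)
  have w: "0 \<le> ?w \<psi>" for \<psi>
    using \<eta> by simp
  have push: "(\<integral>\<^sup>+ \<psi>. ennreal (q\<Psi> x \<psi>) * ennreal (g \<psi>) \<partial>count_space S)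
      = (\<integral>\<^sup>+ \<theta>. ennreal (g (\<Psi> \<theta>)) \<partial>?M)" for g :: "'p \<Rightarrow> real"
    by (rule distributed_nn_integral[OF dist]) simp
  have "posterior_risk \<nu> p f (LRSE_loss \<Psi> p\<Psi> \<eta>) x a
      = (\<integral>\<^sup>+ \<theta>. ennreal (of_bool (\<Psi> \<theta> \<noteq> a) * ?w (\<Psi> \<theta>)) \<partial>?M)"
    by (rule posterior_risk_eq_nn_integral[OF x, where g = "\<lambda>\<psi>. of_bool (\<psi> \<noteq> a) * ?w \<psi>"])
       (auto simp: N LRSE_loss_def)
  also have "\<dots> = (\<integral>\<^sup>+ \<psi>. ennreal (q\<Psi> x \<psi>) * ennreal (of_bool (\<psi> \<noteq> a) * ?w \<psi>) \<partial>count_space S)"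
    by (rule push[symmetric])
  finally have risk: "posterior_risk \<nu> p f (LRSE_loss \<Psi> p\<Psi> \<eta>) x a = \<dots>" .
  have "ennreal (q\<Psi> x a / max \<eta> (p\<Psi> a))
      = (\<integral>\<^sup>+ \<psi>. ennreal (q\<Psi> x a / max \<eta> (p\<Psi> a)) * indicator {a} \<psi> \<partial>count_space S)"
    using a by (simp add: nn_integral_cmult_indicator)
  then have "posterior_risk \<nu> p f (LRSE_loss \<Psi> p\<Psi> \<eta>) x a + ennreal (q\<Psi> x a / max \<eta> (p\<Psi> a))
      = (\<integral>\<^sup>+ \<psi>. ennreal (q\<Psi> x \<psi>) * ennreal (of_bool (\<psi> \<noteq> a) * ?w \<psi>)
             + ennreal (q\<Psi> x a / max \<eta> (p\<Psi> a)) * indicator {a} \<psi> \<partial>count_space S)"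
    by (simp add: risk nn_integral_add)
  also have "\<dots> = (\<integral>\<^sup>+ \<psi>. ennreal (q\<Psi> x \<psi>) * ennreal (?w \<psi>) \<partial>count_space S)"
    using q w by (intro nn_integral_cong) (auto simp: ennreal_mult[symmetric] split: split_indicator)
  finally show ?thesis
    by (simp add: push)
qed

text \<open>
  The truncation at \<open>\<eta>\<close> bounds the weights by \<open>1 / \<eta>\<close>. Finiteness is what allows the total to be
  cancelled; with an infinite total every action could have infinite risk and be Bayes.
\<close>
lemma (in bayes_model) posterior_expected_weight_finite:
  assumes x: "x \<in> sample_points \<mu> \<nu> p f" and \<eta>: "0 < \<eta>"
  shows "(\<integral>\<^sup>+ \<theta>. ennreal (1 / max \<eta> (p\<Psi> (\<Psi> \<theta>))) \<partial>posterior_measure \<nu> p f x) < \<infinity>"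
proof -
  interpret P: prob_space "posterior_measure \<nu> p f x"
    using x by (rule prob_space_posterior)
  have "(\<integral>\<^sup>+ \<theta>. ennreal (1 / max \<eta> (p\<Psi> (\<Psi> \<theta>))) \<partial>posterior_measure \<nu> p f x)
      \<le> (\<integral>\<^sup>+ \<theta>. ennreal (1 / \<eta>) \<partial>posterior_measure \<nu> p f x)"
    using \<eta> by (intro nn_integral_mono ennreal_leI divide_left_mono) auto
  also have "\<dots> < \<infinity>"
    by (simp add: P.emeasure_space_1)
  finally show ?thesis .
qed

text \<open>
  Truncation only lowers ratios, so a strict maximizer whose own ratio is not truncated stays ahead
  of every competitor.
\<close>
lemma truncated_ratio_less:
  fixes P Q :: "'p \<Rightarrow> real"
  assumes "0 < P a" "0 \<le> Q a" "\<eta> \<le> P b" "Q a / P a < Q b / P b"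
  shows "Q a / max \<eta> (P a) < Q b / max \<eta> (P b)"
proof -
  have "Q a / max \<eta> (P a) \<le> Q a / P a"
    using assms(1,2) by (intro divide_left_mono) auto
  also have "\<dots> < Q b / max \<eta> (P b)"
    using assms(3,4) by (simp add: max_def)
  finally show ?thesis .
qed

lemma is_arg_max_unique_less:
  fixes g :: "'a \<Rightarrow> 'b::linorder"
  assumes max: "is_arg_max g A b" and unique: "\<And>y. is_arg_max g A y \<Longrightarrow> y = b"
    and a: "A a" "a \<noteq> b"
  shows "g a < g b"
proof (rule ccontr)
  assume "\<not> g a < g b"
  then have "is_arg_max g A a"
    using max a(1) by (auto simp: is_arg_max_def)
  with unique a(2) show False
    by blast
qed

text \<open>
  The limit in quantitative form. The bound \<open>\<eta> \<le> p\<Psi> b\<close> keeps the ratio at the LRSE itself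
  untruncated, and uniqueness makes its lead strict over every competitor.
\<close>
lemma (in bayes_model) Bayes_rule_eq_LRSE:
  assumes x: "x \<in> sample_points \<mu> \<nu> p f"
    and N: "\<nu>\<Psi> = count_space S" and pos: "\<And>\<psi>. \<psi> \<in> S \<Longrightarrow> 0 < p\<Psi> \<psi>"
    and LRSE: "is_LRSE \<nu>\<Psi> p\<Psi> q\<Psi> x b"
    and unique: "\<And>\<psi>. is_LRSE \<nu>\<Psi> p\<Psi> q\<Psi> x \<psi> \<Longrightarrow> \<psi> = b"
    and \<eta>: "0 < \<eta>" "\<eta> \<le> p\<Psi> b"
    and Bayes: "is_Bayes_rule \<mu> \<nu> \<nu>\<Psi> p f (LRSE_loss \<Psi> p\<Psi> \<eta>) d"
  shows "d x = b"
proof (rule ccontr)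
  assume neq: "d x \<noteq> b"
  let ?r = "posterior_risk \<nu> p f (LRSE_loss \<Psi> p\<Psi> \<eta>) x"
  let ?h = "\<lambda>a. q\<Psi> x a / max \<eta> (p\<Psi> a)"
  let ?T = "\<integral>\<^sup>+ \<theta>. ennreal (1 / max \<eta> (p\<Psi> (\<Psi> \<theta>))) \<partial>posterior_measure \<nu> p f x"
  have b: "b \<in> S"
    using LRSE by (simp add: is_LRSE_def is_arg_max_def N)
  have d: "d x \<in> S" and le: "?r (d x) \<le> ?r b"
    using Bayes x b by (auto simp: is_Bayes_rule_def is_arg_min_def N not_less)
  have q: "0 \<le> q\<Psi> x (d x)"
    using marginal_posterior[OF x] d by (auto simp: has_marginal_density_def N)
  have "relative_belief p\<Psi> q\<Psi> x (d x) < relative_belief p\<Psi> q\<Psi> x b"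
  proof (rule is_arg_max_unique_less[where g = "relative_belief p\<Psi> q\<Psi> x"])
    show "is_arg_max (relative_belief p\<Psi> q\<Psi> x) (\<lambda>\<psi>. \<psi> \<in> space \<nu>\<Psi>) b"
      using LRSE by (simp only: is_LRSE_def)
    show "\<psi> = b" if "is_arg_max (relative_belief p\<Psi> q\<Psi> x) (\<lambda>\<psi>. \<psi> \<in> space \<nu>\<Psi>) \<psi>" for \<psi>
      by (rule unique) (simp only: is_LRSE_def that)
    show "d x \<in> space \<nu>\<Psi>" "d x \<noteq> b"
      using d neq by (simp_all add: N)
  qed
  then have "?h (d x) < ?h b"
    using pos[OF d] q \<eta>(2) by (intro truncated_ratio_less) (auto simp: relative_belief_def)
  moreover have "0 \<le> ?h (d x)"
    using q \<eta>(1) by simp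
  ultimately have h: "ennreal (?h (d x)) < ennreal (?h b)"
    by (simp add: ennreal_less_iff)
  have sums: "?r (d x) + ennreal (?h (d x)) = ?T" "?r b + ennreal (?h b) = ?T"
    using LRSE_loss_posterior_risk[OF x N _ \<eta>(1)] d b by auto
  have "?r (d x) < \<infinity>"
    using sums(1) posterior_expected_weight_finite[OF x \<eta>(1)]
    by (metis add_top_right_ennreal ennreal_add_eq_top infinity_ennreal_def less_top)
  then have "?r (d x) + ennreal (?h (d x)) < ?r (d x) + ennreal (?h b)"
    using h by (simp add: ennreal_add_left_cancel_less)
  also have "\<dots> \<le> ?r b + ennreal (?h b)"
    using le by (rule add_right_mono)
  finally show False
    by (simp add: sums)
qed

theorem theorem2:
  fixes \<mu> :: "'x measure" and \<nu> :: "'t measure" and \<nu>\<Psi> :: "'p measure"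
    and f :: "'t \<Rightarrow> 'x \<Rightarrow> real" and p :: "'t \<Rightarrow> real" and \<Psi> :: "'t \<Rightarrow> 'p"
    and p\<Psi> :: "'p \<Rightarrow> real" and q\<Psi> :: "'x \<Rightarrow> 'p \<Rightarrow> real"
    and S :: "'p set" and \<psi>LRSE :: "'x \<Rightarrow> 'p" and \<delta> :: "real \<Rightarrow> 'x \<Rightarrow> 'p"
  assumes model: "bayes_model \<mu> \<nu> \<nu>\<Psi> f p \<Psi> p\<Psi> q\<Psi>"
    and countable: "countable S"
    and counting: "\<nu>\<Psi> = count_space S"
    and pos: "\<And>\<psi>. \<psi> \<in> S \<Longrightarrow> 0 < p\<Psi> \<psi>"
    and LRSE: "\<And>x. x \<in> sample_points \<mu> \<nu> p f \<Longrightarrow> is_LRSE \<nu>\<Psi> p\<Psi> q\<Psi> x (\<psi>LRSE x)"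
    and LRSE_unique: "\<And>x \<psi>. x \<in> sample_points \<mu> \<nu> p f \<Longrightarrow> is_LRSE \<nu>\<Psi> p\<Psi> q\<Psi> x \<psi> \<Longrightarrow> \<psi> = \<psi>LRSE x"
    and Bayes: "\<And>\<eta>. 0 < \<eta> \<Longrightarrow> is_Bayes_rule \<mu> \<nu> \<nu>\<Psi> p f (LRSE_loss \<Psi> p\<Psi> \<eta>) (\<delta> \<eta>)"
  shows "\<forall>x\<in>sample_points \<mu> \<nu> p f.
           limitin (discrete_topology S) (\<lambda>\<eta>. \<delta> \<eta> x) (\<psi>LRSE x) (at_right 0)"
proof
  fix x assume x: "x \<in> sample_points \<mu> \<nu> p f"
  interpret bayes_model \<mu> \<nu> \<nu>\<Psi> f p \<Psi> p\<Psi> q\<Psi>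
    by (rule model)
  have b: "\<psi>LRSE x \<in> S"
    using LRSE[OF x] by (simp add: is_LRSE_def is_arg_max_def counting)
  have "\<forall>\<^sub>F \<eta> in at_right 0. \<eta> \<in> {0<..<p\<Psi> (\<psi>LRSE x)}"
    using pos[OF b] by (rule eventually_at_right_real)
  then have "\<forall>\<^sub>F \<eta> in at_right 0. \<delta> \<eta> x = \<psi>LRSE x"
  proof eventually_elim
    case (elim \<eta>)
    then have "0 < \<eta>" "\<eta> \<le> p\<Psi> (\<psi>LRSE x)"
      by simp_all
    then show ?case
      by (intro Bayes_rule_eq_LRSE[OF x counting pos LRSE[OF x] LRSE_unique[OF x] _ _ Bayes])
  qed
  with b show "limitin (discrete_topology S) (\<lambda>\<eta>. \<delta> \<eta> x) (\<psi>LRSE x) (at_right 0)"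
    by (intro limitin_eventually) auto
qed

end
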